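(* Let $P_{YZ}$ be a joint probability distribution of random variables $Y,Z$ with finite alphabets and let $\varepsilon\in[0,1)$. Then $$\widehat\lambda^{\varepsilon}_{\min}(Y|Z)_P=\bar\lambda^{\varepsilon}_{\min}(Y|Z)_P.$$ Consequently, for every $K>0$ the constraints $\frac1K\ge\widehat\lambda^{\varepsilon}_{\min}(Y|Z)_P$ and $\frac1K\ge\bar\lambda^{\varepsilon}_{\min}(Y|Z)_P$ are equivalent.
   Context: $\mathbb 1$ is the all-ones vector; $P_Z$ is the marginal of $P_{YZ}$; $\mathbb 1_YP_Z$ is the vector with entries $(y,z)\mapsto P_Z(z)$. Inequalities between vectors are entrywise and $\langle\cdot,\cdot\rangle$ is the Euclidean inner product. Define $$\widehat\lambda^{\varepsilon}_{\min}(Y|Z)_P:=\min\{\lambda:\ \lambda\,\mathbb 1_YP_Z\ge Q_{YZ},\ Q_{YZ}\le P_{YZ},\ \langle\mathbb 1_{YZ},Q_{YZ}\rangle\ge1-\varepsilon;\ \lambda\ge0,\ Q_{YZ}\ge0\},$$ $$\bar\lambda^{\varepsilon}_{\min}(Y|Z)_P:=\min\{\lambda:\ \lambda\,\mathbb 1_YP_Z\ge P_{YZ}-T_{YZ},\ \langle\mathbb 1_{YZ},T_{YZ}\rangle\le\varepsilon;\ \lambda\ge0,\ T_{YZ}\ge0\},$$ where $\lambda$ is real and $Q_{YZ},T_{YZ}$ are real vectors indexed by pairs $(y,z)$. *)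

theory Defs
  imports "HOL-Probability.Probability"
begin

text \<open>
  A vector indexed by pairs \<open>(y, z)\<close> has type \<open>real ^ ('y \<times> 'z)\<close>; on it \<open>\<le>\<close> is the entrywise
  order and \<open>\<bullet>\<close> the Euclidean inner product.
\<close>

definition joint_vec :: "('y::finite \<times> 'z::finite) pmf \<Rightarrow> real ^ ('y \<times> 'z)" where
  "joint_vec P = (\<chi> yz. pmf P yz)"

definition ones_vec :: "real ^ 'i::finite" where
  "ones_vec = (\<chi> i. 1)"

definition ones_marginal_vec :: "('y::finite \<times> 'z::finite) pmf \<Rightarrow> real ^ ('y \<times> 'z)" where
  "ones_marginal_vec P = (\<chi> yz. pmf (map_pmf snd P) (snd yz))"

definition hat_feasible :: "real \<Rightarrow> ('y::finite \<times> 'z::finite) pmf \<Rightarrow> real set" where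
  "hat_feasible \<epsilon> P =
     {l. \<exists>Q :: real ^ ('y \<times> 'z).
           l *\<^sub>R ones_marginal_vec P \<ge> Q \<and> Q \<le> joint_vec P \<and> ones_vec \<bullet> Q \<ge> 1 - \<epsilon> \<and>
           l \<ge> 0 \<and> Q \<ge> 0}"

definition bar_feasible :: "real \<Rightarrow> ('y::finite \<times> 'z::finite) pmf \<Rightarrow> real set" where
  "bar_feasible \<epsilon> P =
     {l. \<exists>T :: real ^ ('y \<times> 'z).
           l *\<^sub>R ones_marginal_vec P \<ge> joint_vec P - T \<and> ones_vec \<bullet> T \<le> \<epsilon> \<and>
           l \<ge> 0 \<and> T \<ge> 0}"

text \<open>
  These sets are infinite, so \<open>Min\<close> does not apply. \<open>LEAST\<close> denotes the minimum whenever it is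
  attained, and is unspecified otherwise.
\<close>

definition hat_lambda_min :: "real \<Rightarrow> ('y::finite \<times> 'z::finite) pmf \<Rightarrow> real" where
  "hat_lambda_min \<epsilon> P = (LEAST l. l \<in> hat_feasible \<epsilon> P)"

definition bar_lambda_min :: "real \<Rightarrow> ('y::finite \<times> 'z::finite) pmf \<Rightarrow> real" where
  "bar_lambda_min \<epsilon> P = (LEAST l. l \<in> bar_feasible \<epsilon> P)"

definition is_minimum :: "real set \<Rightarrow> real \<Rightarrow> bool" where
  "is_minimum S m \<longleftrightarrow> m \<in> S \<and> (\<forall>x\<in>S. m \<le> x)"

end

(* For fixed l the entrywise largest Q allowed by the two upper bounds is min (l P_Z) P_YZ, and the
   entrywise smallest T allowed by the lower bounds is P_YZ minus that vector. As P_YZ sums to 1,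
   both feasible sets therefore consist of the l >= 0 at which the continuous function
   l |-> sum of min (l P_Z(z)) P_YZ(y,z) is at least 1 - eps. *)
theory Submission
  imports Defs
begin

definition capped_mass :: "('y::finite \<times> 'z::finite) pmf \<Rightarrow> real \<Rightarrow> real" where
  "capped_mass P l = (\<Sum>yz\<in>UNIV. min (l * pmf (map_pmf snd P) (snd yz)) (pmf P yz))"

lemma inner_ones_vec: "ones_vec \<bullet> Q = (\<Sum>i\<in>UNIV. Q $ i)"
  by (simp add: inner_vec_def ones_vec_def)

lemma sum_pmf_UNIV: "(\<Sum>x\<in>UNIV. pmf (P :: 'a::finite pmf) x) = 1"
  by (rule sum_pmf_eq_1) auto

text \<open>The event \<open>{x}\<close> lies in the fibre of \<open>f\<close> over
  \<open>f x\<close>, so monotonicity of the measure applies.\<close>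

lemma pmf_le_pmf_map: "pmf P x \<le> pmf (map_pmf f P) (f x)"
  unfolding pmf_map unfolding measure_pmf_single[symmetric]
  by (rule measure_pmf.finite_measure_mono) auto

lemma hat_feasible_eq:
  "hat_feasible \<epsilon> P = {l. 0 \<le> l \<and> 1 - \<epsilon> \<le> capped_mass P l}"
proof (intro equalityI subsetI)
  fix l assume "l \<in> hat_feasible \<epsilon> P"
  then obtain Q where Q: "Q \<le> l *\<^sub>R ones_marginal_vec P" "Q \<le> joint_vec P"
      "1 - \<epsilon> \<le> ones_vec \<bullet> Q" and "0 \<le> l"
    unfolding hat_feasible_def by blast
  have "ones_vec \<bullet> Q \<le> capped_mass P l"
    unfolding inner_ones_vec capped_mass_def using Q(1,2)
    by (intro sum_mono) (auto simp: less_eq_vec_def ones_marginal_vec_def joint_vec_def)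
  with Q(3) \<open>0 \<le> l\<close> show "l \<in> {l. 0 \<le> l \<and> 1 - \<epsilon> \<le> capped_mass P l}"
    by simp
next
  fix l assume l: "l \<in> {l. 0 \<le> l \<and> 1 - \<epsilon> \<le> capped_mass P l}"
  \<comment> \<open>This witness attains \<open>capped_mass P l\<close> exactly; its entries are
    nonnegative because \<open>0 \<le> l\<close>.\<close>
  define Q where "Q = (\<chi> yz. min (l * pmf (map_pmf snd P) (snd yz)) (pmf P yz))"
  have "ones_vec \<bullet> Q = capped_mass P l"
    by (simp add: inner_ones_vec capped_mass_def Q_def)
  with l have "l *\<^sub>R ones_marginal_vec P \<ge> Q \<and> Q \<le> joint_vec P \<and> ones_vec \<bullet> Q \<ge> 1 - \<epsilon> \<and>
      l \<ge> 0 \<and> Q \<ge> 0"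
    by (auto simp: less_eq_vec_def ones_marginal_vec_def joint_vec_def Q_def)
  then show "l \<in> hat_feasible \<epsilon> P"
    unfolding hat_feasible_def by blast
qed

lemma bar_feasible_eq:
  "bar_feasible \<epsilon> P = {l. 0 \<le> l \<and> 1 - \<epsilon> \<le> capped_mass P l}"
proof (intro equalityI subsetI)
  fix l assume "l \<in> bar_feasible \<epsilon> P"
  then obtain T where T: "joint_vec P - T \<le> l *\<^sub>R ones_marginal_vec P" "0 \<le> T"
      "ones_vec \<bullet> T \<le> \<epsilon>" and "0 \<le> l"
    unfolding bar_feasible_def by blast
  \<comment> \<open>\<open>P - T\<close> takes the place of \<open>Q\<close>: the condition
    \<open>0 \<le> T\<close> supplies the bound by \<open>P\<close>. Its entries may be negative,
    which is harmless for an upper bound on the sum.\<close>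
  have "(\<Sum>yz\<in>UNIV. pmf P yz - T $ yz) \<le> capped_mass P l"
    unfolding capped_mass_def using T(1,2)
    by (intro sum_mono) (auto simp: less_eq_vec_def ones_marginal_vec_def joint_vec_def)
  with T(3) \<open>0 \<le> l\<close> show "l \<in> {l. 0 \<le> l \<and> 1 - \<epsilon> \<le> capped_mass P l}"
    by (simp add: sum_subtractf sum_pmf_UNIV inner_ones_vec)
next
  fix l assume l: "l \<in> {l. 0 \<le> l \<and> 1 - \<epsilon> \<le> capped_mass P l}"
  \<comment> \<open>Entrywise this is the positive part of \<open>P - l * P_Z\<close>, the excess
    over the cap.\<close>
  define T where
    "T = (\<chi> yz. pmf P yz - min (l * pmf (map_pmf snd P) (snd yz)) (pmf P yz))"
  have "ones_vec \<bullet> T = 1 - capped_mass P l"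
    by (simp add: inner_ones_vec capped_mass_def T_def sum_subtractf sum_pmf_UNIV)
  with l have "l *\<^sub>R ones_marginal_vec P \<ge> joint_vec P - T \<and> ones_vec \<bullet> T \<le> \<epsilon> \<and>
      l \<ge> 0 \<and> T \<ge> 0"
    by (auto simp: less_eq_vec_def ones_marginal_vec_def joint_vec_def T_def)
  then show "l \<in> bar_feasible \<epsilon> P"
    unfolding bar_feasible_def by blast
qed

text \<open>At level 1 the cap never bites, since a joint probability is at most its marginal. This
  yields a feasible level for every \<open>\<epsilon> \<ge> 0\<close>.\<close>

lemma capped_mass_one: "capped_mass P 1 = 1"
  by (simp add: capped_mass_def min_absorb2 pmf_le_pmf_map sum_pmf_UNIV)

text \<open>Such a set contains its infimum, which is therefore the value of \<open>LEAST\<close>.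
  This rules out an equality between unspecified values.\<close>

lemma is_minimum_Least:
  assumes "closed S" and "S \<noteq> {}" and "bdd_below S"
  shows "is_minimum S (LEAST l. l \<in> S)"
proof -
  have "Inf S \<in> S"
    using assms by (intro closed_contains_Inf)
  moreover have "Inf S \<le> x" if "x \<in> S" for x
    using that assms(3) by (rule cInf_lower)
  moreover from calculation have "(LEAST l. l \<in> S) = Inf S"
    by (rule Least_equality)
  ultimately show ?thesis
    by (simp add: is_minimum_def)
qed

lemma is_minimum_Least_capped_mass:
  assumes "0 \<le> \<epsilon>"
  shows "is_minimum {l. 0 \<le> l \<and> 1 - \<epsilon> \<le> capped_mass P l}
    (LEAST l. l \<in> {l. 0 \<le> l \<and> 1 - \<epsilon> \<le> capped_mass P l})"
proof (rule is_minimum_Least)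
  \<comment> \<open>A finite sum of minima of a linear function and a constant is continuous, so its
    superlevel sets are closed.\<close>
  have "continuous_on UNIV (capped_mass P)"
    unfolding capped_mass_def by (intro continuous_intros)
  then show "closed {l. 0 \<le> l \<and> 1 - \<epsilon> \<le> capped_mass P l}"
    by (intro closed_Collect_conj closed_Collect_le continuous_intros)
  show "{l. 0 \<le> l \<and> 1 - \<epsilon> \<le> capped_mass P l} \<noteq> {}"
    using assms by (auto intro!: exI[of _ 1] simp: capped_mass_one)
  show "bdd_below {l. 0 \<le> l \<and> 1 - \<epsilon> \<le> capped_mass P l}"
    by (rule bdd_belowI[of _ 0]) simp
qed

theorem mainTheorem5:
  fixes P :: "('y::finite \<times> 'z::finite) pmf" and \<epsilon> :: real
  assumes "0 \<le> \<epsilon>" and "\<epsilon> < 1"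
  shows "is_minimum (hat_feasible \<epsilon> P) (hat_lambda_min \<epsilon> P) \<and>
         is_minimum (bar_feasible \<epsilon> P) (bar_lambda_min \<epsilon> P) \<and>
         hat_lambda_min \<epsilon> P = bar_lambda_min \<epsilon> P \<and>
         (\<forall>K::real. K > 0 \<longrightarrow>
            (1 / K \<ge> hat_lambda_min \<epsilon> P \<longleftrightarrow> 1 / K \<ge> bar_lambda_min \<epsilon> P))"
  \<comment> \<open>Once both feasible sets are rewritten to the same set, the two
    \<open>LEAST\<close> terms coincide syntactically, and the equivalence for \<open>K\<close> is
    immediate.\<close>
  using is_minimum_Least_capped_mass[OF assms(1), of P]
  unfolding hat_lambda_min_def bar_lambda_min_def hat_feasible_eq bar_feasible_eq by blast

end
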